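(* Let $\alpha\in\mathbb R$. The inequality \[ \sup_{n\ge1}\Big|\Big(\sum_{k=n}^\infty\frac{x_k}k\Big)-x_n\Big|n^\alpha\le A\sup_{k\ge1}|x_k|k^\alpha \] holds for all real sequences $x\in\mathcal D(C^* )$ with \[ A=\begin{cases}\infty,&\alpha\le0;\\ 1+\dfrac1\alpha,&\alpha>0.\end{cases} \] It holds for all nonnegative sequences $x\in\mathcal D(C^* )$ with \[ A=\begin{cases}\infty,&\alpha\le0;\\ \dfrac1\alpha,&0<\alpha<1;\\ 1,&\alpha\ge1.\end{cases} \] In each case the value of $A$ is best possible (the least element of $[0,\infty]$ for which the inequality holds for all the indicated $x$).
   Context: Sequences are indexed by the positive integers; suprema take values in $[0,\infty]$. $\mathcal D(C^* )$ is the set of all real sequences $x$ for which $\sum_{k=1}^\infty\frac{x_k}k$ converges (possibly conditionally) in $\mathbb R$. Convention: $\infty\cdot0=0$. *)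

theory Defs
  imports "HOL-Analysis.Analysis"
begin

text \<open>
  A real sequence indexed by the positive integers is a function \<^typ>\<open>nat \<Rightarrow> real\<close> of which only
  the values at arguments \<open>\<ge> 1\<close> are ever used. Constants and suprema live in \<^typ>\<open>ennreal\<close>,
  where \<open>\<infinity> * 0 = 0 * \<infinity> = 0\<close>.
\<close>

definition Cstar_domain :: "(nat \<Rightarrow> real) set" where
  "Cstar_domain = {x. summable (\<lambda>k. x (Suc k) / real (Suc k))}"

text \<open>The tail sum over all indices \<open>\<ge> n\<close>, shifted so that it starts at \<open>0\<close>; for \<open>n \<ge> 1\<close>.\<close>

definition Cstar :: "(nat \<Rightarrow> real) \<Rightarrow> nat \<Rightarrow> real" where
  "Cstar x n = (\<Sum>k. x (n + k) / real (n + k))"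

definition weighted_sup :: "real \<Rightarrow> (nat \<Rightarrow> real) \<Rightarrow> ennreal" where
  "weighted_sup \<alpha> y = (SUP n\<in>{1..}. ennreal (\<bar>y n\<bar> * real n powr \<alpha>))"

definition nonneg_seq :: "(nat \<Rightarrow> real) \<Rightarrow> bool" where
  "nonneg_seq x \<longleftrightarrow> (\<forall>k\<ge>1. 0 \<le> x k)"

definition admissible_constants :: "real \<Rightarrow> (nat \<Rightarrow> real) set \<Rightarrow> ennreal set" where
  "admissible_constants \<alpha> X =
     {A. \<forall>x\<in>X. weighted_sup \<alpha> (\<lambda>n. Cstar x n - x n) \<le> A * weighted_sup \<alpha> x}"

definition is_least_element :: "'a::order \<Rightarrow> 'a set \<Rightarrow> bool" where
  "is_least_element a S \<longleftrightarrow> a \<in> S \<and> (\<forall>b\<in>S. a \<le> b)"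

end

theory Submission
  imports Defs
begin

text \<open>
  The basic identity is
  \<open>Cstar x n - x n = Cstar x (n + 1) - (1 - 1 / n) * x n\<close>: the current entry separates from
  a tail that no longer contains it, so the two parts can be bounded, and chosen, independently.

  Let \<open>\<alpha> > 0\<close> and \<open>\<bar>x k\<bar> \<le> M * k powr (- \<alpha>)\<close> for all \<open>k\<close>. Comparison of the sum of
  \<open>k powr (- \<alpha> - 1)\<close> over \<open>k > n\<close> with the integral bounds the tail by
  \<open>M / \<alpha> * n powr (- \<alpha>)\<close> (\<open>abs_Cstar_Suc_le\<close>), and the other part is at most
  \<open>M * n powr (- \<alpha>)\<close>. For real sequences the two bounds add up to the factor \<open>1 + 1 / \<alpha>\<close>.
  For nonnegative sequences both parts are nonnegative, so that their difference is bounded by the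
  larger of the two, which gives the factor \<open>max (1 / \<alpha>) 1\<close>; the case distinction at
  \<open>\<alpha> = 1\<close> is exactly this maximum.

  Both bounds are asymptotically attained. The sequence that vanishes before \<open>N\<close>, equals
  \<open>s * N powr (- \<alpha>)\<close> at \<open>N\<close> and \<open>t * k powr (- \<alpha>)\<close> for \<open>k > N\<close>, with
  \<open>\<bar>s\<bar> \<le> 1\<close> and \<open>\<bar>t\<bar> \<le> 1\<close>, has weighted supremum at most \<open>1\<close>, whereas the left-hand side at
  \<open>N\<close> tends to \<open>\<bar>t / \<alpha> - s\<bar>\<close> as \<open>N\<close> grows (\<open>admissible_ge_spike_tail\<close>). The choice
  \<open>(s, t) = (- 1, 1)\<close> yields \<open>1 + 1 / \<alpha>\<close>, and the nonnegative choices \<open>(0, 1)\<close> and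
  \<open>(1, 0)\<close> yield \<open>1 / \<alpha>\<close> and \<open>1\<close>.

  If \<open>\<alpha> \<le> 0\<close>, truncations of \<open>k powr (- \<alpha>)\<close> have weighted supremum at most \<open>1\<close>, but their
  tail sums from \<open>1\<close> dominate the partial sums of the harmonic series, so no finite constant works
  (\<open>admissible_nonpos_exponent\<close>).
\<close>

section \<open>Tails of the series with terms \<open>k powr (- \<alpha> - 1)\<close>\<close>

text \<open>
  By the mean value theorem the increment of the antiderivative \<open>- (z powr (- \<alpha>)) / \<alpha>\<close> over
  \<open>[t, t + 1]\<close> is a value of the decreasing function \<open>z powr (- \<alpha> - 1)\<close> on that interval.
\<close>

lemma powr_neg_increment_bounds:
  fixes \<alpha> t :: real
  assumes "\<alpha> > 0" "t > 0"
  shows "(t + 1) powr (- \<alpha> - 1) \<le> t powr (- \<alpha>) / \<alpha> - (t + 1) powr (- \<alpha>) / \<alpha>"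
    and "t powr (- \<alpha>) / \<alpha> - (t + 1) powr (- \<alpha>) / \<alpha> \<le> t powr (- \<alpha> - 1)"
proof -
  have "\<exists>z>t. z < t + 1 \<and> - ((t + 1) powr (- \<alpha>)) / \<alpha> - - (t powr (- \<alpha>)) / \<alpha>
          = (t + 1 - t) * z powr (- \<alpha> - 1)"
  proof (rule MVT2)
    fix z assume z: "t \<le> z" "z \<le> t + 1"
    have "((\<lambda>z. - (z powr (- \<alpha>)) / \<alpha>) has_real_derivative - (- \<alpha> * z powr (- \<alpha> - 1)) / \<alpha>) (at z)"
      using z assms by (auto intro!: derivative_eq_intros)
    moreover have "- (- \<alpha> * z powr (- \<alpha> - 1)) / \<alpha> = z powr (- \<alpha> - 1)"
      using assms by simp
    ultimately show "((\<lambda>z. - (z powr (- \<alpha>)) / \<alpha>) has_real_derivative z powr (- \<alpha> - 1)) (at z)"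
      by simp
  qed simp
  then obtain z where z: "t < z" "z < t + 1"
    and eq: "t powr (- \<alpha>) / \<alpha> - (t + 1) powr (- \<alpha>) / \<alpha> = z powr (- \<alpha> - 1)"
    by auto
  show "(t + 1) powr (- \<alpha> - 1) \<le> t powr (- \<alpha>) / \<alpha> - (t + 1) powr (- \<alpha>) / \<alpha>"
    unfolding eq using z assms by (intro powr_mono2') auto
  show "t powr (- \<alpha>) / \<alpha> - (t + 1) powr (- \<alpha>) / \<alpha> \<le> t powr (- \<alpha> - 1)"
    unfolding eq using z assms by (intro powr_mono2') auto
qed

lemma telescoping_powr_sums:
  fixes \<alpha> :: real
  assumes "\<alpha> > 0"
  shows "(\<lambda>j. real (n + j) powr (- \<alpha>) / \<alpha> - real (n + Suc j) powr (- \<alpha>) / \<alpha>)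
           sums (real n powr (- \<alpha>) / \<alpha>)"
proof -
  have "filterlim (\<lambda>j. real (n + j)) at_top sequentially"
    by (intro filterlim_compose[OF filterlim_real_sequentially] filterlim_add_const_nat_at_top
          | simp add: add.commute[of n])+
  then have "(\<lambda>j. real (n + j) powr (- \<alpha>)) \<longlonglongrightarrow> 0"
    using assms by (intro tendsto_neg_powr) auto
  then have "(\<lambda>j. real (n + j) powr (- \<alpha>) / \<alpha>) \<longlonglongrightarrow> 0"
    by (rule tendsto_divide_zero)
  from telescope_sums'[OF this] show ?thesis
    by simp
qed

text \<open>
  The integral test in discrete form: the terms lie between two consecutive increments of
  \<open>k powr (- \<alpha>) / \<alpha>\<close>, and these telescope. The gap between the two bounds is negligible as
  \<open>n\<close> grows, which makes them good enough for the sharpness of the constants as well.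
\<close>

lemma powr_tail:
  fixes \<alpha> :: real
  assumes "\<alpha> > 0" "n \<ge> 1"
  shows summable_powr_tail: "summable (\<lambda>j. real (Suc n + j) powr (- \<alpha> - 1))"
    and powr_tail_le: "(\<Sum>j. real (Suc n + j) powr (- \<alpha> - 1)) \<le> real n powr (- \<alpha>) / \<alpha>"
    and powr_tail_ge: "real (Suc n) powr (- \<alpha>) / \<alpha> \<le> (\<Sum>j. real (Suc n + j) powr (- \<alpha> - 1))"
proof -
  let ?d = "\<lambda>m j. real (m + j) powr (- \<alpha>) / \<alpha> - real (m + Suc j) powr (- \<alpha>) / \<alpha>"
  have le: "real (Suc n + j) powr (- \<alpha> - 1) \<le> ?d n j" for j
    using powr_neg_increment_bounds(1)[of \<alpha> "real (n + j)"] assms by (simp add: algebra_simps)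
  have ge: "?d (Suc n) j \<le> real (Suc n + j) powr (- \<alpha> - 1)" for j
    using powr_neg_increment_bounds(2)[of \<alpha> "real (Suc n + j)"] assms by (simp add: algebra_simps)
  note sums = telescoping_powr_sums[OF assms(1)]
  show summ: "summable (\<lambda>j. real (Suc n + j) powr (- \<alpha> - 1))"
    by (rule summable_comparison_test'[OF sums_summable[OF sums[of n]], of 0]) (use le in auto)
  show "(\<Sum>j. real (Suc n + j) powr (- \<alpha> - 1)) \<le> real n powr (- \<alpha>) / \<alpha>"
    using suminf_le[OF le summ sums_summable[OF sums[of n]]] sums_unique[OF sums[of n]] by simp
  show "real (Suc n) powr (- \<alpha>) / \<alpha> \<le> (\<Sum>j. real (Suc n + j) powr (- \<alpha> - 1))"
    using suminf_le[OF ge sums_summable[OF sums[of "Suc n"]] summ] sums_unique[OF sums[of "Suc n"]]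
    by simp
qed

section \<open>The upper bounds\<close>

lemma weighted_sup_le_iff:
  assumes "M \<ge> 0"
  shows "weighted_sup \<alpha> y \<le> ennreal M \<longleftrightarrow> (\<forall>n\<ge>1. \<bar>y n\<bar> * real n powr \<alpha> \<le> M)"
  using assms by (auto simp: weighted_sup_def SUP_le_iff)

lemma weighted_sup_ge: "n \<ge> 1 \<Longrightarrow> ennreal (\<bar>y n\<bar> * real n powr \<alpha>) \<le> weighted_sup \<alpha> y"
  unfolding weighted_sup_def by (rule SUP_upper) simp

lemma mem_Cstar_domain_iff_tail:
  "x \<in> Cstar_domain \<longleftrightarrow> summable (\<lambda>k. x (n + k) / real (n + k))"
  using summable_iff_shift[of "\<lambda>k. x k / real k" n] summable_Suc_iff[of "\<lambda>k. x k / real k"]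
  by (simp add: Cstar_domain_def add.commute)

lemma Cstar_minus_self:
  assumes "x \<in> Cstar_domain"
  shows "Cstar x n - x n = Cstar x (Suc n) - (1 - 1 / real n) * x n"
proof -
  have "summable (\<lambda>k. x (n + k) / real (n + k))"
    using assms mem_Cstar_domain_iff_tail by blast
  from suminf_split_head[OF this] have "Cstar x n = x n / real n + Cstar x (Suc n)"
    by (simp add: Cstar_def)
  then show ?thesis by (simp add: algebra_simps)
qed

lemma abs_Cstar_Suc_le:
  fixes \<alpha> :: real
  assumes "\<alpha> > 0" "n \<ge> 1" and bound: "\<And>k. k \<ge> 1 \<Longrightarrow> \<bar>x k\<bar> * real k powr \<alpha> \<le> M"
  shows "\<bar>Cstar x (Suc n)\<bar> * real n powr \<alpha> \<le> M / \<alpha>"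
proof -
  have M: "M \<ge> 0" using bound[of 1] by simp
  note summ = summable_powr_tail[OF assms(1,2)]
  have "norm (\<Sum>j. x (Suc n + j) / real (Suc n + j))
          \<le> (\<Sum>j. M * real (Suc n + j) powr (- \<alpha> - 1))"
  proof (rule norm_suminf_le)
    fix j
    let ?k = "Suc n + j"
    have "\<bar>x ?k\<bar> \<le> M * real ?k powr (- \<alpha>)"
      using bound[of ?k] by (simp add: powr_minus_divide field_simps)
    then have "\<bar>x ?k\<bar> / real ?k \<le> M * real ?k powr (- \<alpha>) / real ?k"
      by (rule divide_right_mono) simp
    also have "\<dots> = M * real ?k powr (- \<alpha> - 1)"
      using powr_diff[of "real ?k" "- \<alpha>" 1] by simp
    finally show "norm (x ?k / real ?k) \<le> M * real ?k powr (- \<alpha> - 1)" by simp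
  qed (intro summable_mult summ)
  also have "\<dots> = M * (\<Sum>j. real (Suc n + j) powr (- \<alpha> - 1))"
    by (rule suminf_mult[OF summ])
  also have "\<dots> \<le> M * (real n powr (- \<alpha>) / \<alpha>)"
    by (rule mult_left_mono[OF powr_tail_le[OF assms(1,2)] M])
  finally have "\<bar>Cstar x (Suc n)\<bar> \<le> M * (real n powr (- \<alpha>) / \<alpha>)"
    by (simp add: Cstar_def)
  from mult_right_mono[OF this, of "real n powr \<alpha>"] show ?thesis
    using assms by (simp add: powr_minus_divide)
qed

lemma abs_self_part_le:
  assumes "n \<ge> 1" "\<bar>x n\<bar> * real n powr \<alpha> \<le> M"
  shows "\<bar>(1 - 1 / real n) * x n\<bar> * real n powr \<alpha> \<le> M"
proof -
  have "\<bar>1 - 1 / real n\<bar> * (\<bar>x n\<bar> * real n powr \<alpha>) \<le> 1 * (\<bar>x n\<bar> * real n powr \<alpha>)"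
    using assms(1) by (intro mult_right_mono) auto
  with assms(2) show ?thesis by (simp add: abs_mult mult.assoc)
qed

text \<open>
  Reduction to real numbers. If the weighted supremum of \<open>x\<close> is infinite, the right-hand side is
  infinite because \<open>c\<close> is nonzero; otherwise that supremum is a real bound \<open>M\<close>.
\<close>

lemma admissible_constantsI:
  fixes \<alpha> c :: real
  assumes "c > 0"
    and step: "\<And>x M n. \<lbrakk>x \<in> X; n \<ge> 1; \<And>k. k \<ge> 1 \<Longrightarrow> \<bar>x k\<bar> * real k powr \<alpha> \<le> M\<rbrakk>
               \<Longrightarrow> \<bar>Cstar x n - x n\<bar> * real n powr \<alpha> \<le> c * M"
  shows "ennreal c \<in> admissible_constants \<alpha> X"
  unfolding admissible_constants_def
proof (intro CollectI ballI)
  fix x assume x: "x \<in> X"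
  show "weighted_sup \<alpha> (\<lambda>n. Cstar x n - x n) \<le> ennreal c * weighted_sup \<alpha> x"
  proof (cases "weighted_sup \<alpha> x")
    case top
    then show ?thesis using assms(1) by (simp add: ennreal_mult_top)
  next
    case (real M)
    then have "\<bar>x k\<bar> * real k powr \<alpha> \<le> M" if "k \<ge> 1" for k
      using that weighted_sup_le_iff[of M \<alpha> x] by simp
    then have "weighted_sup \<alpha> (\<lambda>n. Cstar x n - x n) \<le> ennreal (c * M)"
      using step[OF x] real assms(1) by (subst weighted_sup_le_iff) auto
    then show ?thesis using real assms(1) by (simp add: ennreal_mult)
  qed
qed

lemma admissible_real:
  fixes \<alpha> :: real
  assumes "\<alpha> > 0"
  shows "ennreal (1 + 1 / \<alpha>) \<in> admissible_constants \<alpha> Cstar_domain"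
proof (rule admissible_constantsI)
  fix x M and n :: nat
  assume x: "x \<in> Cstar_domain" and n: "n \<ge> 1"
    and bound: "\<And>k. k \<ge> 1 \<Longrightarrow> \<bar>x k\<bar> * real k powr \<alpha> \<le> M"
  have "\<bar>Cstar x n - x n\<bar> * real n powr \<alpha>
          \<le> (\<bar>Cstar x (Suc n)\<bar> + \<bar>(1 - 1 / real n) * x n\<bar>) * real n powr \<alpha>"
    unfolding Cstar_minus_self[OF x] by (intro mult_right_mono abs_triangle_ineq4) simp
  also have "\<dots> \<le> M / \<alpha> + M"
    using abs_Cstar_Suc_le[OF assms n bound] abs_self_part_le[of n x \<alpha> M] n bound[OF n]
    by (simp add: distrib_right)
  finally show "\<bar>Cstar x n - x n\<bar> * real n powr \<alpha> \<le> (1 + 1 / \<alpha>) * M"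
    by (simp add: algebra_simps)
qed (use assms in \<open>simp add: add_pos_pos\<close>)

text \<open>
  For nonnegative sequences the tail and the remaining part of \<open>x n\<close> have the same sign and partly
  cancel in the difference, so the larger of the two bounds replaces their sum.
\<close>

lemma admissible_nonneg:
  fixes \<alpha> :: real
  assumes "\<alpha> > 0"
  shows "ennreal (max (1 / \<alpha>) 1) \<in> admissible_constants \<alpha> {x \<in> Cstar_domain. nonneg_seq x}"
proof (rule admissible_constantsI)
  fix x M and n :: nat
  assume x: "x \<in> {x \<in> Cstar_domain. nonneg_seq x}" and n: "n \<ge> 1"
    and bound: "\<And>k. k \<ge> 1 \<Longrightarrow> \<bar>x k\<bar> * real k powr \<alpha> \<le> M"
  define a where "a = Cstar x (Suc n)"
  define b where "b = (1 - 1 / real n) * x n"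
  have M: "M \<ge> 0" using bound[of 1] by simp
  have "summable (\<lambda>k. x (Suc n + k) / real (Suc n + k))"
    using x mem_Cstar_domain_iff_tail by blast
  then have "a \<ge> 0"
    unfolding a_def Cstar_def using x
    by (intro suminf_nonneg) (auto simp: nonneg_seq_def simp del: of_nat_add of_nat_Suc)
  moreover have "b \<ge> 0"
    unfolding b_def using x n by (auto simp: nonneg_seq_def)
  ultimately have "\<bar>a - b\<bar> \<le> max \<bar>a\<bar> \<bar>b\<bar>" by linarith
  then have "\<bar>a - b\<bar> * real n powr \<alpha> \<le> max \<bar>a\<bar> \<bar>b\<bar> * real n powr \<alpha>"
    by (rule mult_right_mono) simp
  also have "\<dots> = max (\<bar>a\<bar> * real n powr \<alpha>) (\<bar>b\<bar> * real n powr \<alpha>)"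
    by (simp add: max_mult_distrib_right)
  also have "\<dots> \<le> max (M / \<alpha>) M"
    using abs_Cstar_Suc_le[OF assms n bound] abs_self_part_le[of n x \<alpha> M] n bound[OF n]
    unfolding a_def b_def by (intro max.mono) simp_all
  also have "\<dots> = max (1 / \<alpha>) 1 * M"
    using M by (simp add: max_mult_distrib_right)
  finally show "\<bar>Cstar x n - x n\<bar> * real n powr \<alpha> \<le> max (1 / \<alpha>) 1 * M"
    using x by (simp add: Cstar_minus_self a_def b_def)
qed simp

text \<open>
  Owing to \<open>\<infinity> * 0 = 0\<close> this is not vacuous: a sequence with weighted supremum \<open>0\<close> vanishes at all
  positive indices, and then so does the left-hand side.
\<close>

lemma infinity_admissible: "\<infinity> \<in> admissible_constants \<alpha> X"
  unfolding admissible_constants_def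
proof (intro CollectI ballI)
  fix x assume "x \<in> X"
  show "weighted_sup \<alpha> (\<lambda>n. Cstar x n - x n) \<le> \<infinity> * weighted_sup \<alpha> x"
  proof (cases "weighted_sup \<alpha> x = 0")
    case True
    then have "x n = 0" if "n \<ge> 1" for n
      using weighted_sup_le_iff[of 0 \<alpha> x] that
      by (auto simp: mult_le_0_iff)
    then have "weighted_sup \<alpha> (\<lambda>n. Cstar x n - x n) \<le> ennreal 0"
      by (subst weighted_sup_le_iff) (auto simp: Cstar_def)
    then show ?thesis by simp
  next
    case False
    then show ?thesis by (simp add: ennreal_top_mult)
  qed
qed

section \<open>Sharpness\<close>

lemma admissible_ge_ratio:
  assumes "A \<in> admissible_constants \<alpha> X" "x \<in> X" "n \<ge> 1"
    and "\<And>k. k \<ge> 1 \<Longrightarrow> \<bar>x k\<bar> * real k powr \<alpha> \<le> 1"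
  shows "ennreal (\<bar>Cstar x n - x n\<bar> * real n powr \<alpha>) \<le> A"
proof -
  have "weighted_sup \<alpha> x \<le> 1"
    using weighted_sup_le_iff[of 1 \<alpha> x] assms(4) by simp
  then have "A * weighted_sup \<alpha> x \<le> A"
    using mult_left_mono[of "weighted_sup \<alpha> x" 1 A] by simp
  moreover have "ennreal (\<bar>Cstar x n - x n\<bar> * real n powr \<alpha>) \<le> A * weighted_sup \<alpha> x"
    using weighted_sup_ge[OF assms(3), of "\<lambda>n. Cstar x n - x n" \<alpha>] assms(1,2)
    by (auto simp: admissible_constants_def intro: order_trans)
  ultimately show ?thesis by simp
qed

text \<open>
  The family of near-extremal sequences. The coefficients \<open>s\<close> of the entry at \<open>N\<close> and \<open>t\<close> of the
  tail are separate because \<open>x N\<close> and the tail enter \<open>Cstar x N - x N\<close> with opposite signs.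
\<close>

definition spike_tail :: "real \<Rightarrow> real \<Rightarrow> real \<Rightarrow> nat \<Rightarrow> nat \<Rightarrow> real" where
  "spike_tail \<alpha> s t N k = (if k < N then 0 else if k = N then s else t) * real k powr (- \<alpha>)"

lemma spike_tail_bound:
  assumes "\<bar>s\<bar> \<le> 1" "\<bar>t\<bar> \<le> 1" "k \<ge> 1"
  shows "\<bar>spike_tail \<alpha> s t N k\<bar> * real k powr \<alpha> \<le> 1"
  using assms by (auto simp: spike_tail_def abs_mult powr_minus mult.assoc)

lemma spike_tail_Cstar:
  fixes \<alpha> :: real
  assumes "\<alpha> > 0" "N \<ge> 1"
  shows spike_tail_in_domain: "spike_tail \<alpha> s t N \<in> Cstar_domain"
    and Cstar_spike_tail:
      "Cstar (spike_tail \<alpha> s t N) (Suc N) = t * (\<Sum>j. real (Suc N + j) powr (- \<alpha> - 1))"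
proof -
  have eq: "spike_tail \<alpha> s t N (Suc N + j) / real (Suc N + j)
      = t * real (Suc N + j) powr (- \<alpha> - 1)" for j
    using powr_diff[of "real (Suc N + j)" "- \<alpha>" 1]
    by (simp add: spike_tail_def)
  have "summable (\<lambda>j. spike_tail \<alpha> s t N (Suc N + j) / real (Suc N + j))"
    unfolding eq by (intro summable_mult summable_powr_tail assms)
  then show "spike_tail \<alpha> s t N \<in> Cstar_domain"
    using mem_Cstar_domain_iff_tail by blast
  show "Cstar (spike_tail \<alpha> s t N) (Suc N) = t * (\<Sum>j. real (Suc N + j) powr (- \<alpha> - 1))"
    unfolding Cstar_def eq by (intro suminf_mult summable_powr_tail assms)
qed

lemma powr_tail_asymptotic:
  fixes \<alpha> :: real
  assumes "\<alpha> > 0"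
  shows "(\<lambda>n. (\<Sum>j. real (Suc n + j) powr (- \<alpha> - 1)) * real n powr \<alpha>) \<longlonglongrightarrow> 1 / \<alpha>"
proof (rule tendsto_sandwich)
  have "(\<lambda>n. (real n / real (Suc n)) powr \<alpha> / \<alpha>) \<longlonglongrightarrow> 1 powr \<alpha> / \<alpha>"
    using assms by (intro tendsto_intros LIMSEQ_n_over_Suc_n) auto
  then show "(\<lambda>n. (real n / real (Suc n)) powr \<alpha> / \<alpha>) \<longlonglongrightarrow> 1 / \<alpha>" by simp
  show "\<forall>\<^sub>F n in sequentially. (real n / real (Suc n)) powr \<alpha> / \<alpha>
          \<le> (\<Sum>j. real (Suc n + j) powr (- \<alpha> - 1)) * real n powr \<alpha>"
    using eventually_ge_at_top[of 1]
  proof eventually_elim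
    case (elim n)
    from mult_right_mono[OF powr_tail_ge[OF assms elim], of "real n powr \<alpha>"]
    show ?case by (simp add: powr_divide powr_minus_divide mult.commute)
  qed
  show "\<forall>\<^sub>F n in sequentially. (\<Sum>j. real (Suc n + j) powr (- \<alpha> - 1)) * real n powr \<alpha> \<le> 1 / \<alpha>"
    using eventually_ge_at_top[of 1]
  proof eventually_elim
    case (elim n)
    from mult_right_mono[OF powr_tail_le[OF assms elim], of "real n powr \<alpha>"]
    show ?case using elim by (simp add: powr_minus_divide)
  qed
qed simp

text \<open>
  In the limit the factor \<open>1 - 1 / N\<close> at the entry \<open>N\<close> tends to \<open>1\<close> and the normalised tail to
  \<open>1 / \<alpha>\<close>; a constant that dominates every member of the family dominates the limit.
\<close>

lemma admissible_ge_spike_tail: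
  fixes \<alpha> s t :: real
  assumes "\<alpha> > 0" "\<bar>s\<bar> \<le> 1" "\<bar>t\<bar> \<le> 1" and A: "A \<in> admissible_constants \<alpha> X"
    and X: "\<And>N. N \<ge> 1 \<Longrightarrow> spike_tail \<alpha> s t N \<in> X"
  shows "ennreal \<bar>t / \<alpha> - s\<bar> \<le> A"
proof -
  let ?T = "\<lambda>N. (\<Sum>j. real (Suc N + j) powr (- \<alpha> - 1))"
  let ?f = "\<lambda>N. \<bar>t * (?T N * real N powr \<alpha>) - (1 - 1 / real N) * s\<bar>"
  have "(\<lambda>N. 1 / real N) \<longlonglongrightarrow> 0" by (rule lim_1_over_n)
  then have "?f \<longlonglongrightarrow> \<bar>t * (1 / \<alpha>) - (1 - 0) * s\<bar>"
    using powr_tail_asymptotic[OF assms(1)] by (intro tendsto_intros)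
  then have "(\<lambda>N. ennreal (?f N)) \<longlonglongrightarrow> ennreal \<bar>t / \<alpha> - s\<bar>"
    by (intro tendsto_ennrealI) simp
  moreover have "\<forall>\<^sub>F N in sequentially. ennreal (?f N) \<le> A"
    using eventually_ge_at_top[of 1]
  proof eventually_elim
    case (elim N)
    let ?x = "spike_tail \<alpha> s t N"
    have "Cstar ?x N - ?x N = t * ?T N - (1 - 1 / real N) * (s * real N powr (- \<alpha>))"
      using Cstar_minus_self[OF spike_tail_in_domain[OF assms(1) elim], of s t N]
        Cstar_spike_tail[OF assms(1) elim, of s t]
      by (simp add: spike_tail_def)
    then have "\<bar>Cstar ?x N - ?x N\<bar> * real N powr \<alpha>
        = \<bar>(t * ?T N - (1 - 1 / real N) * (s * real N powr (- \<alpha>))) * real N powr \<alpha>\<bar>"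
      by (simp add: abs_mult)
    also have "(t * ?T N - (1 - 1 / real N) * (s * real N powr (- \<alpha>))) * real N powr \<alpha>
        = t * (?T N * real N powr \<alpha>)
          - (1 - 1 / real N) * s * (real N powr (- \<alpha>) * real N powr \<alpha>)"
      by (simp only: left_diff_distrib mult.assoc)
    also have "real N powr (- \<alpha>) * real N powr \<alpha> = 1"
      using elim by (simp add: powr_minus)
    finally have "\<bar>Cstar ?x N - ?x N\<bar> * real N powr \<alpha> = ?f N" by simp
    with admissible_ge_ratio[OF A X[OF elim] elim spike_tail_bound[OF assms(2,3)]]
    show ?case by simp
  qed
  ultimately show ?thesis
    by (intro tendsto_upperbound) auto
qed

text \<open>
  The truncation to indices \<open>k \<le> m\<close> puts the sequence into the domain, and at \<open>n = 1\<close> its tail sum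
  is at least the \<open>m\<close>-th harmonic number, because \<open>k powr (- \<alpha>) \<ge> 1\<close>.
\<close>

lemma admissible_nonpos_exponent:
  fixes \<alpha> :: real
  assumes "\<alpha> \<le> 0" and A: "A \<in> admissible_constants \<alpha> X"
    and X: "{x \<in> Cstar_domain. nonneg_seq x} \<subseteq> X"
  shows "A = \<infinity>"
proof (cases A)
  case (real c)
  have "\<forall>\<^sub>F m in sequentially. harm m > c + 1"
    using harm_at_top by (simp add: filterlim_at_top_dense)
  then obtain m where m: "harm m > c + 1"
    by (auto simp: eventually_sequentially)
  define x where "x k = (if k \<le> m then real k powr (- \<alpha>) else 0)" for k
  have dom: "x \<in> Cstar_domain"
    unfolding mem_Cstar_domain_iff_tail[of x 0]
    by (rule summable_finite[of "{..m}"]) (auto simp: x_def)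
  have "harm m = (\<Sum>k<m. 1 / real (1 + k))"
    by (simp add: harm_def divide_inverse sum.atLeast1_atMost_eq)
  also have "\<dots> \<le> (\<Sum>k<m. x (1 + k) / real (1 + k))"
    using assms(1)
    by (intro sum_mono divide_right_mono) (auto simp: x_def intro!: ge_one_powr_ge_zero)
  also have "\<dots> = Cstar x 1"
    unfolding Cstar_def by (rule suminf_finite[symmetric]) (auto simp: x_def)
  finally have "c + 1 < Cstar x 1" using m by simp
  moreover have "x 1 \<le> 1" by (simp add: x_def)
  ultimately have "c < \<bar>Cstar x 1 - x 1\<bar> * real 1 powr \<alpha>" by simp
  moreover have "ennreal (\<bar>Cstar x 1 - x 1\<bar> * real 1 powr \<alpha>) \<le> A"
  proof (rule admissible_ge_ratio[OF A])
    show "x \<in> X" using dom X by (auto simp: nonneg_seq_def x_def)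
    show "\<bar>x k\<bar> * real k powr \<alpha> \<le> 1" if "k \<ge> 1" for k
      using that by (simp add: x_def powr_minus)
  qed simp
  ultimately show ?thesis using real by simp
qed simp

theorem theorem3p11:
  fixes \<alpha> :: real
  shows "is_least_element
           (if \<alpha> \<le> 0 then \<infinity> else ennreal (1 + 1 / \<alpha>))
           (admissible_constants \<alpha> Cstar_domain)
       \<and> is_least_element
           (if \<alpha> \<le> 0 then \<infinity> else if \<alpha> < 1 then ennreal (1 / \<alpha>) else 1)
           (admissible_constants \<alpha> {x \<in> Cstar_domain. nonneg_seq x})"
proof (cases "\<alpha> \<le> 0")
  case True
  then show ?thesis
    using admissible_nonpos_exponent[OF True]
      infinity_admissible[of \<alpha> Cstar_domain]
      infinity_admissible[of \<alpha> "{x \<in> Cstar_domain. nonneg_seq x}"]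
    by (auto simp: is_least_element_def)
next
  case False
  then have pos: "\<alpha> > 0" by simp
  have "ennreal (1 + 1 / \<alpha>) \<le> A" if "A \<in> admissible_constants \<alpha> Cstar_domain" for A
    using admissible_ge_spike_tail[OF pos _ _ that, of "- 1" 1] spike_tail_in_domain[OF pos] pos
    by (simp add: add.commute)
  moreover have "ennreal (max (1 / \<alpha>) 1) \<le> A"
    if A: "A \<in> admissible_constants \<alpha> {x \<in> Cstar_domain. nonneg_seq x}" for A
  proof -
    have mem: "spike_tail \<alpha> s t N \<in> {x \<in> Cstar_domain. nonneg_seq x}"
      if "s \<ge> 0" "t \<ge> 0" "N \<ge> 1" for s t N
      using that spike_tail_in_domain[OF pos] by (simp add: nonneg_seq_def spike_tail_def)
    show ?thesis
      using admissible_ge_spike_tail[OF pos _ _ A, of 0 1] mem[of 0 1]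
        admissible_ge_spike_tail[OF pos _ _ A, of 1 0] mem[of 1 0] pos
      by (simp add: max_def)
  qed
  moreover have "ennreal (max (1 / \<alpha>) 1) = (if \<alpha> < 1 then ennreal (1 / \<alpha>) else 1)"
    using pos by (auto simp: max_def field_simps)
  ultimately show ?thesis
    using False admissible_real[OF pos] admissible_nonneg[OF pos]
    by (auto simp: is_least_element_def)
qed

end
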